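(* Let $\mathcal{C}\subseteq\mathbb{R}^{2n}$ be the set defined by the half-spaces $\mathcal{C}_i$ and index sets $\mathcal{L},\mathcal{I}^\ell$ as in the context, let $\gamma,\epsilon>0$, and let $\mathcal{C}^s=\{x\in\mathbb{R}^{2n} : B(x)\ge 0\}$ be the 0-superlevel set of the associated function $B$. Then $\mathcal{C}^s\subseteq\mathcal{C}$. Moreover, suppose that (Assumption 1) the set $\operatorname{Proj}_n(\mathcal{C})$ is compact and, for every $I\in\mathcal{S}_\cap$, a point $y_I\in\mathcal{C}$ is chosen with $h_i(y_I)>0$ for all $i\in I$. Define $$\delta := \min_{I\in\mathcal{S}_\cap,\ i\in I} h_i(y_I) > 0 .$$ If $\gamma\delta>\epsilon$, then $\operatorname{Proj}_n(\mathcal{C}^s)=\operatorname{Proj}_n(\mathcal{C})$.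
   Context: Points of $\mathbb{R}^{2n}$ are written $x=(x_1,x_2)$ with $x_1,x_2\in\mathbb{R}^n$. For a set $S\subseteq\mathbb{R}^{2n}$, $\operatorname{Proj}_n(S)\subseteq\mathbb{R}^n$ is its projection on the first $n$ components. Half-spaces: let $\mathcal{I}=\{1,\dots,r\}$. For $i\in\mathcal{I}$, let $a_i\in\mathbb{R}^n$, $b_i\in\mathbb{R}$ with $\|a_i\|\ne 0$ and $b_i\neq 0$, such that for $i\ne i'$ the augmented vectors $(a_i,b_i)$ and $(a_{i'},b_{i'})$ are linearly independent. Set $h_i(x)=a_i^\top x_1+b_i$ and $\mathcal{C}_i=\{x\in\mathbb{R}^{2n} : h_i(x)\ge 0\}$. Desired safe set: $\mathcal{L}\subset\mathbb{N}$ is a nonempty finite index set and $\mathcal{I}^\ell\subseteq\mathcal{I}$ is nonempty for each $\ell\in\mathcal{L}$. Set $\mathcal{C}=\bigcup_{\ell\in\mathcal{L}}\bigcap_{i\in\mathcal{I}^\ell}\mathcal{C}_i$, assumed nonempty. $\mathcal{S}_\cap$ is the collection of all $I\subseteq\mathcal{I}$ such that $\left(\bigcap_{i\in I}\mathcal{C}_i\right)\cap\mathcal{C}\neq\emptyset$. Construction of $B$: given parameters $\gamma,\epsilon>0$, for $1\le i\le r$ put $B_i(x)=h_i(x)$ and $B_{i+r}(x)=a_i^\top x_2+\gamma(a_i^\top x_1+b_i)-\epsilon$. Put $\bar{\mathcal{L}}=\mathcal{L}$, $\bar{\mathcal{I}}^\ell=\mathcal{I}^\ell\cup\{i+r : i\in\mathcal{I}^\ell\}$,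 and $B(x)=\max_{\ell\in\bar{\mathcal{L}}}\min_{i\in\bar{\mathcal{I}}^\ell}B_i(x)$. *)

theory Defs
  imports "HOL-Analysis.Analysis"
begin

text \<open>The space of dimension \<open>2n\<close> is the product \<open>(real ^ 'n) \<times> (real ^ 'n)\<close>, so that a point
  \<open>x = (x\<^sub>1, x\<^sub>2)\<close> has \<open>x\<^sub>1 = fst x\<close> and \<open>x\<^sub>2 = snd x\<close>.\<close>

type_synonym 'n state = "(real ^ 'n) \<times> (real ^ 'n)"

definition Proj :: "'n state set \<Rightarrow> (real ^ 'n) set" where
  "Proj S = fst ` S"

definition h :: "(nat \<Rightarrow> real ^ 'n) \<Rightarrow> (nat \<Rightarrow> real) \<Rightarrow> nat \<Rightarrow> 'n state \<Rightarrow> real" where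
  "h a b i x = a i \<bullet> fst x + b i"

definition halfspace :: "(nat \<Rightarrow> real ^ 'n) \<Rightarrow> (nat \<Rightarrow> real) \<Rightarrow> nat \<Rightarrow> 'n state set" where
  "halfspace a b i = {x. h a b i x \<ge> 0}"

definition safe_set ::
  "(nat \<Rightarrow> real ^ 'n) \<Rightarrow> (nat \<Rightarrow> real) \<Rightarrow> nat set \<Rightarrow> (nat \<Rightarrow> nat set) \<Rightarrow> 'n state set" where
  "safe_set a b L J = (\<Union>l\<in>L. \<Inter>i\<in>J l. halfspace a b i)"

text \<open>The collection \<open>\<S>\<^sub>\<inter>\<close>. The empty index set belongs to it whenever the safe set is nonempty,
  because an intersection over the empty set is the whole space.\<close>

definition S_cap ::
  "nat \<Rightarrow> (nat \<Rightarrow> real ^ 'n) \<Rightarrow> (nat \<Rightarrow> real) \<Rightarrow> nat set \<Rightarrow> (nat \<Rightarrow> nat set) \<Rightarrow> nat set set" where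
  "S_cap r a b L J = {I. I \<subseteq> {1..r} \<and> (\<Inter>i\<in>I. halfspace a b i) \<inter> safe_set a b L J \<noteq> {}}"

text \<open>The components \<open>B\<^sub>1, \<dots>, B\<^bsub>2r\<^esub>\<close>; values at indices outside \<open>{1..2 * r}\<close> are irrelevant.\<close>

definition B_comp ::
  "nat \<Rightarrow> (nat \<Rightarrow> real ^ 'n) \<Rightarrow> (nat \<Rightarrow> real) \<Rightarrow> real \<Rightarrow> real \<Rightarrow> nat \<Rightarrow> 'n state \<Rightarrow> real" where
  "B_comp r a b \<gamma> \<epsilon> i x =
     (if i \<le> r then h a b i x
      else a (i - r) \<bullet> snd x + \<gamma> * (a (i - r) \<bullet> fst x + b (i - r)) - \<epsilon>)"

definition J_bar :: "nat \<Rightarrow> (nat \<Rightarrow> nat set) \<Rightarrow> nat \<Rightarrow> nat set" where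
  "J_bar r J l = J l \<union> {i + r | i. i \<in> J l}"

definition B ::
  "nat \<Rightarrow> (nat \<Rightarrow> real ^ 'n) \<Rightarrow> (nat \<Rightarrow> real) \<Rightarrow> nat set \<Rightarrow> (nat \<Rightarrow> nat set) \<Rightarrow> real \<Rightarrow> real
    \<Rightarrow> 'n state \<Rightarrow> real" where
  "B r a b L J \<gamma> \<epsilon> x = (MAX l\<in>L. MIN i\<in>J_bar r J l. B_comp r a b \<gamma> \<epsilon> i x)"

definition superlevel_set ::
  "nat \<Rightarrow> (nat \<Rightarrow> real ^ 'n) \<Rightarrow> (nat \<Rightarrow> real) \<Rightarrow> nat set \<Rightarrow> (nat \<Rightarrow> nat set) \<Rightarrow> real \<Rightarrow> real
    \<Rightarrow> 'n state set" where
  "superlevel_set r a b L J \<gamma> \<epsilon> = {x. B r a b L J \<gamma> \<epsilon> x \<ge> 0}"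

definition delta ::
  "nat \<Rightarrow> (nat \<Rightarrow> real ^ 'n) \<Rightarrow> (nat \<Rightarrow> real) \<Rightarrow> nat set \<Rightarrow> (nat \<Rightarrow> nat set)
    \<Rightarrow> (nat set \<Rightarrow> 'n state) \<Rightarrow> real" where
  "delta r a b L J y = Min {h a b i (y I) | I i. I \<in> S_cap r a b L J \<and> i \<in> I}"

text \<open>Linear independence of two vectors as a family: \<open>independent {v, w}\<close> alone would
  also hold for \<open>v = w \<noteq> 0\<close>.\<close>

definition independent_pair :: "'v::real_vector \<Rightarrow> 'v \<Rightarrow> bool" where
  "independent_pair v w \<longleftrightarrow> v \<noteq> w \<and> independent {v, w}"

end

theory Submission imports Defs begin

text \<open>Only the first component matters for membership in the safe set. If \<open>x\<close> lies in the
  \<open>l\<close>-th polyhedron and \<open>z\<close> is strictly inside it with margin \<open>\<delta>\<close>, the velocity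
  \<open>\<gamma> (z\<^sub>1 - x\<^sub>1)\<close> towards \<open>z\<close> turns every component \<open>B\<^bsub>i+r\<^esub>\<close> into
  \<open>\<gamma> h\<^sub>i(z) - \<epsilon> \<ge> \<gamma> \<delta> - \<epsilon>\<close>.\<close>

lemma mem_safe_set_iff: "x \<in> safe_set a b L J \<longleftrightarrow> (\<exists>l\<in>L. \<forall>i\<in>J l. 0 \<le> h a b i x)"
  by (simp add: safe_set_def halfspace_def)

text \<open>Over finite nonempty index sets, a maximum is nonnegative iff some entry is, and a
  minimum iff all entries are. This removes \<open>MAX\<close> and \<open>MIN\<close>, so that only
  linear inequalities remain.\<close>

lemma mem_superlevel_set_iff:
  assumes "finite L" "L \<noteq> {}" and J: "\<And>l. l \<in> L \<Longrightarrow> J l \<noteq> {} \<and> J l \<subseteq> {1..r}"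
  shows "x \<in> superlevel_set r a b L J \<gamma> \<epsilon> \<longleftrightarrow>
    (\<exists>l\<in>L. \<forall>i\<in>J l. 0 \<le> h a b i x \<and> \<epsilon> \<le> a i \<bullet> snd x + \<gamma> * h a b i x)"
proof -
  have "0 \<le> (MIN i\<in>J_bar r J l. B_comp r a b \<gamma> \<epsilon> i x) \<longleftrightarrow>
      (\<forall>i\<in>J l. 0 \<le> h a b i x \<and> \<epsilon> \<le> a i \<bullet> snd x + \<gamma> * h a b i x)" if "l \<in> L" for l
  proof -
    have eq: "J_bar r J l = J l \<union> (\<lambda>i. i + r) ` J l"
      by (auto simp: J_bar_def)
    have fin: "finite (J l)" and ne: "J l \<noteq> {}" and sub: "\<And>i. i \<in> J l \<Longrightarrow> 1 \<le> i \<and> i \<le> r"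
      using J[OF that] finite_subset[of "J l" "{1..r}"] by auto
    have "0 \<le> (MIN i\<in>J_bar r J l. B_comp r a b \<gamma> \<epsilon> i x) \<longleftrightarrow>
        (\<forall>i\<in>J l. 0 \<le> B_comp r a b \<gamma> \<epsilon> i x) \<and> (\<forall>i\<in>J l. 0 \<le> B_comp r a b \<gamma> \<epsilon> (i + r) x)"
      using fin ne by (auto simp: eq Min_ge_iff)
    \<comment> \<open>The bounds on \<open>i\<close> select the branch of \<open>B_comp\<close>:
      \<open>i \<le> r\<close> gives the first, and \<open>1 \<le> i\<close> gives
      \<open>i + r > r\<close>, hence the second. With \<open>i = 0\<close> the shifted index
      \<open>r\<close> would still fall in the first branch.\<close>
    moreover have "B_comp r a b \<gamma> \<epsilon> i x = h a b i x"
        "B_comp r a b \<gamma> \<epsilon> (i + r) x = a i \<bullet> snd x + \<gamma> * h a b i x - \<epsilon>" if "i \<in> J l" for i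
      using sub[OF that] by (auto simp: B_comp_def h_def)
    ultimately show ?thesis
      by auto
  qed
  then show ?thesis
    using assms(1,2) by (simp add: superlevel_set_def B_def Max_ge_iff)
qed

text \<open>Both \<open>I\<close> and \<open>i\<close> come from finite sets, since
  \<open>I \<subseteq> {1..r}\<close>. This makes the \<open>Min\<close> in \<open>delta\<close> a
  genuine minimum.\<close>

lemma finite_S_cap_values:
  "finite {h a b i (y I) | I i. I \<in> S_cap r a b L J \<and> i \<in> I}"
  by (rule finite_subset[of _ "(\<lambda>(I, i). h a b i (y I)) ` (Pow {1..r} \<times> {1..r})"])
    (force simp: S_cap_def)+

text \<open>The point \<open>x\<close> itself witnesses the nonempty intersection. Hence the chosen
  point \<open>y (J l)\<close> is strictly feasible for every constraint of the polyhedron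
  containing \<open>x\<close>.\<close>

lemma S_cap_memI:
  assumes "l \<in> L" "J l \<subseteq> {1..r}" "\<And>i. i \<in> J l \<Longrightarrow> 0 \<le> h a b i x"
  shows "J l \<in> S_cap r a b L J"
proof -
  have "x \<in> (\<Inter>i\<in>J l. halfspace a b i) \<inter> safe_set a b L J"
    using assms by (auto simp: mem_safe_set_iff halfspace_def)
  then show ?thesis
    using assms(2) by (auto simp: S_cap_def)
qed

theorem mainTheorem1:
  fixes r :: nat
    and a :: "nat \<Rightarrow> real ^ 'n"
    and b :: "nat \<Rightarrow> real"
    and L :: "nat set"
    and J :: "nat \<Rightarrow> nat set"
    and \<gamma> \<epsilon> :: real
  assumes a_nz: "\<And>i. i \<in> {1..r} \<Longrightarrow> norm (a i) \<noteq> 0"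
    and b_nz: "\<And>i. i \<in> {1..r} \<Longrightarrow> b i \<noteq> 0"
    and indep: "\<And>i i'. i \<in> {1..r} \<Longrightarrow> i' \<in> {1..r} \<Longrightarrow> i \<noteq> i'
                  \<Longrightarrow> independent_pair (a i, b i) (a i', b i')"
    and L: "finite L" "L \<noteq> {}"
    and J: "\<And>l. l \<in> L \<Longrightarrow> J l \<noteq> {} \<and> J l \<subseteq> {1..r}"
    and C_ne: "safe_set a b L J \<noteq> {}"
    and pos: "\<gamma> > 0" "\<epsilon> > 0"
  shows "superlevel_set r a b L J \<gamma> \<epsilon> \<subseteq> safe_set a b L J \<and>
    (\<forall>y :: nat set \<Rightarrow> 'n state.
       compact (Proj (safe_set a b L J)) \<longrightarrow>
       (\<forall>I\<in>S_cap r a b L J. y I \<in> safe_set a b L J \<and> (\<forall>i\<in>I. h a b i (y I) > 0)) \<longrightarrow>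
       delta r a b L J y > 0 \<and>
       (\<gamma> * delta r a b L J y > \<epsilon> \<longrightarrow>
          Proj (superlevel_set r a b L J \<gamma> \<epsilon>) = Proj (safe_set a b L J)))"
proof -
  have super: "x \<in> superlevel_set r a b L J \<gamma> \<epsilon> \<longleftrightarrow>
      (\<exists>l\<in>L. \<forall>i\<in>J l. 0 \<le> h a b i x \<and> \<epsilon> \<le> a i \<bullet> snd x + \<gamma> * h a b i x)" for x
    by (rule mem_superlevel_set_iff[OF L]) (fact J)
  have sub: "superlevel_set r a b L J \<gamma> \<epsilon> \<subseteq> safe_set a b L J"
    unfolding subset_iff super mem_safe_set_iff by blast
  have "delta r a b L J y > 0 \<and>
      (\<gamma> * delta r a b L J y > \<epsilon> \<longrightarrow>
        Proj (superlevel_set r a b L J \<gamma> \<epsilon>) = Proj (safe_set a b L J))"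
    if y: "\<forall>I\<in>S_cap r a b L J. y I \<in> safe_set a b L J \<and> (\<forall>i\<in>I. h a b i (y I) > 0)"
    for y :: "nat set \<Rightarrow> 'n state"
  proof (intro conjI impI)
    let ?V = "{h a b i (y I) | I i. I \<in> S_cap r a b L J \<and> i \<in> I}"
    obtain x l where l: "l \<in> L" and "\<forall>i\<in>J l. 0 \<le> h a b i x"
      using C_ne unfolding ex_in_conv[symmetric] mem_safe_set_iff by blast
    then have "J l \<in> S_cap r a b L J"
      using J by (blast intro: S_cap_memI)
    \<comment> \<open>The empty index set contributes no values, so the set \<open>J l\<close>,
      nonempty and in \<open>S_cap\<close>, is used to keep \<open>Min\<close> away from the empty
      set.\<close>
    then have "?V \<noteq> {}"
      using J[OF l] by blast
    then show "delta r a b L J y > 0"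
      unfolding delta_def using y by (subst Min_gr_iff[OF finite_S_cap_values]) auto
  next
    assume g: "\<gamma> * delta r a b L J y > \<epsilon>"
    \<comment> \<open>Only this inclusion needs work; the reverse one follows from
      \<open>sub\<close> by taking images under \<open>fst\<close>.\<close>
    have "fst x \<in> Proj (superlevel_set r a b L J \<gamma> \<epsilon>)" if x: "x \<in> safe_set a b L J" for x
    proof -
      obtain l where l: "l \<in> L" and hx: "\<forall>i\<in>J l. 0 \<le> h a b i x"
        using x unfolding mem_safe_set_iff by blast
      define z where "z = y (J l)"
      define w where "w = (fst x, \<gamma> *\<^sub>R (fst z - fst x))"
      have I: "J l \<in> S_cap r a b L J"
        using l J hx by (blast intro: S_cap_memI)
      have "0 \<le> h a b i w \<and> \<epsilon> \<le> a i \<bullet> snd w + \<gamma> * h a b i w" if i: "i \<in> J l" for i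
      proof
        show "0 \<le> h a b i w"
          using hx i by (simp add: h_def w_def)
        have "delta r a b L J y \<le> h a b i z"
          unfolding delta_def z_def using I i by (intro Min_le finite_S_cap_values) blast
        then have "\<gamma> * delta r a b L J y \<le> \<gamma> * h a b i z"
          using pos by simp
        \<comment> \<open>The terms in \<open>fst x\<close> cancel, so the lower bound does not
          depend on \<open>x\<close> and one \<open>delta\<close> serves the whole safe set.\<close>
        also have "\<dots> = a i \<bullet> snd w + \<gamma> * h a b i w"
          by (simp add: h_def w_def algebra_simps)
        finally show "\<epsilon> \<le> a i \<bullet> snd w + \<gamma> * h a b i w"
          using g by simp
      qed
      then have "w \<in> superlevel_set r a b L J \<gamma> \<epsilon>"
        using l by (auto simp: super)
      then show ?thesis
        unfolding Proj_def by (rule rev_image_eqI) (simp add: w_def)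
    qed
    then show "Proj (superlevel_set r a b L J \<gamma> \<epsilon>) = Proj (safe_set a b L J)"
      using sub by (auto simp: Proj_def)
  qed
  with sub show ?thesis
    by blast
qed

end
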